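(* Let $r$ be a prime power and $d$ a positive integer. Given a family $\mathcal{F}$ of $(r-1)\frac{d(d+3)}{2}+1$ ellipsoids of volume one in $\mathbb{R}^d$, there exists a partition of $\mathcal{F}$ into $r$ parts $\mathcal{A}_1, \ldots, \mathcal{A}_r$ such that $\bigcap_{j=1}^r \operatorname{conv}\left(\bigcup \mathcal{A}_j\right)$ contains an ellipsoid of volume one.
   Context: An ellipsoid in $\mathbb{R}^d$ is the image of the Euclidean unit ball under an invertible affine map. $\operatorname{conv}$ is the convex hull and $\bigcup \mathcal{A}_j$ the union of the sets in $\mathcal{A}_j$. *)

theory Defs
  imports "HOL-Analysis.Analysis" "HOL-Number_Theory.Prime_Powers"
begin

definition ellipsoid :: "(real ^ 'd) set \<Rightarrow> bool" where
  "ellipsoid E \<longleftrightarrow>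
     (\<exists>(A :: real ^ 'd ^ 'd) c. invertible A \<and> E = (\<lambda>x. A *v x + c) ` cball 0 1)"

end

theory Submission
  imports Defs
begin

text \<open>Every ellipsoid is \<open>L B + c\<close> for the unit ball \<open>B\<close> and a unique lower triangular matrix \<open>L\<close> with
  positive diagonal, so ellipsoids are points of a space of dimension \<open>D = d (d + 3) / 2\<close>. Forget the
  last diagonal entry of \<open>L\<close> and apply the linear Tverberg theorem to \<open>(r - 1) D + 1\<close> points in the
  remaining \<open>D - 1\<close> dimensions: there are \<open>r\<close> parts with convex combinations \<open>(c, M\<^sub>j)\<close> that agree up to
  the last diagonal entry. The ellipsoid \<open>M\<^sub>j B + c\<close> lies in the convex hull of the \<open>j\<close>-th part and grows
  with that entry, so the smallest of them lies in all hulls. The logarithm of the determinant is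
  concave on these matrices, hence its volume is at least one, and it can be shrunk about its centre.\<close>

section \<open>Colourful Caratheodory and conic Tverberg theorems\<close>

text \<open>Gaussian elimination by induction on the equations: a nonzero coefficient
  \<open>a e p\<close> eliminates the unknown \<open>p\<close> from the remaining ones. It supplies
  linear dependencies among more points than coordinates.\<close>

lemma homogeneous_system_nontrivial_solution:
  fixes a :: "'e \<Rightarrow> 'u \<Rightarrow> real"
  assumes "finite J" "finite I" "card J < card I"
  shows "\<exists>\<mu>. (\<exists>i\<in>I. \<mu> i \<noteq> 0) \<and> (\<forall>j\<in>J. (\<Sum>i\<in>I. a j i * \<mu> i) = 0)"
  using assms
proof (induction J arbitrary: I a rule: finite_induct)
  case empty
  then show ?case
    by (intro exI[of _ "\<lambda>_. 1"]) (auto simp: card_gt_0_iff)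
next
  case (insert e J)
  show ?case
  proof (cases "\<forall>i\<in>I. a e i = 0")
    case True
    moreover have "card J < card I"
      using insert by simp
    ultimately show ?thesis
      using insert.IH[OF insert.prems(1), of a] by auto
  next
    case False
    then obtain p where p: "p \<in> I" "a e p \<noteq> 0"
      by blast
    have "card J < card (I - {p})" "finite (I - {p})"
      using insert p by auto
    from insert.IH[OF this(2,1), of "\<lambda>j i. a j i - a j p * a e i / a e p"]
    obtain \<mu> where \<mu>: "\<exists>i\<in>I - {p}. \<mu> i \<noteq> 0"
      and eq: "\<And>j. j \<in> J \<Longrightarrow> (\<Sum>i\<in>I - {p}. (a j i - a j p * a e i / a e p) * \<mu> i) = 0"
      by blast
    define s where "s = - (\<Sum>i\<in>I - {p}. a e i * \<mu> i) / a e p"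
    define \<nu> where "\<nu> = \<mu>(p := s)"
    have split: "(\<Sum>i\<in>I. a j i * \<nu> i) = a j p * s + (\<Sum>i\<in>I - {p}. a j i * \<mu> i)" for j
      by (subst sum.remove[OF insert.prems(1) p(1)]) (simp add: \<nu>_def)
    have "(\<Sum>i\<in>I. a e i * \<nu> i) = 0"
      unfolding split using p by (simp add: s_def)
    moreover have "(\<Sum>i\<in>I. a j i * \<nu> i) = 0" if "j \<in> J" for j
    proof -
      have "(\<Sum>i\<in>I - {p}. (a j i - a j p * a e i / a e p) * \<mu> i)
          = (\<Sum>i\<in>I - {p}. a j i * \<mu> i) + a j p * s"
        by (simp add: s_def left_diff_distrib right_diff_distrib sum_subtractf sum_distrib_left
            sum_divide_distrib mult_ac)
      then show ?thesis
        using eq[OF that] split[of j] by simp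
    qed
    moreover have "\<exists>i\<in>I. \<nu> i \<noteq> 0"
      using \<mu> by (auto simp: \<nu>_def)
    ultimately show ?thesis
      by blast
  qed
qed


text \<open>Pinning the coordinates outside \<open>I\<close> to 0 makes the set a closed slice of a
  product of compact factors, to which Tychonoff's theorem applies.\<close>

lemma compact_function_simplex:
  "compact {l :: 'i \<Rightarrow> real. (\<forall>i\<in>I. 0 \<le> l i \<and> l i \<le> 1) \<and> (\<forall>i. i \<notin> I \<longrightarrow> l i = 0) \<and> sum l I = 1}"
proof -
  let ?box = "\<lambda>i. if i \<in> I then {0..1::real} else {0}"
  have "compactin (product_topology (\<lambda>_. euclidean) UNIV) (PiE UNIV ?box)"
    by (subst compactin_PiE) auto
  then have "compact (PiE UNIV ?box)"
    by (simp add: euclidean_product_topology)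
  moreover have "closed {l :: 'i \<Rightarrow> real. sum l I = 1}"
    by (intro closed_Collect_eq continuous_intros) auto
  ultimately have "compact (PiE UNIV ?box \<inter> {l. sum l I = 1})"
    by (rule compact_Int_closed)
  also have "PiE UNIV ?box \<inter> {l. sum l I = 1} =
      {l. (\<forall>i\<in>I. 0 \<le> l i \<and> l i \<le> 1) \<and> (\<forall>i. i \<notin> I \<longrightarrow> l i = 0) \<and> sum l I = 1}"
    by (auto simp: PiE_iff split: if_splits)
  finally show ?thesis .
qed

text \<open>The expression is the change of a squared norm along a segment, so this is the
  first-order condition at a minimum: for small \<open>t\<close> the linear term dominates.\<close>

lemma quadratic_nonneg_near_zero_imp:
  fixes a b :: real
  assumes "\<And>t. 0 < t \<Longrightarrow> t \<le> 1 \<Longrightarrow> 0 \<le> 2 * t * a + t\<^sup>2 * b"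
  shows "0 \<le> a"
proof (rule ccontr)
  assume "\<not> 0 \<le> a"
  define t where "t = min 1 (- a / (\<bar>b\<bar> + 1))"
  have t: "0 < t" "t \<le> 1" "t \<le> - a / (\<bar>b\<bar> + 1)"
    using \<open>\<not> 0 \<le> a\<close> by (auto simp: t_def intro!: divide_neg_pos)
  then have "t * (\<bar>b\<bar> + 1) \<le> - a"
    by (subst (asm) pos_le_divide_eq) auto
  moreover have "t * b \<le> t * (\<bar>b\<bar> + 1)"
    using t by (intro mult_left_mono) auto
  ultimately have "2 * a + t * b < 0"
    using \<open>\<not> 0 \<le> a\<close> by linarith
  then have "t * (2 * a + t * b) < 0"
    using t by (simp add: mult_pos_neg)
  then show False
    using assms[OF t(1,2)] by (simp add: power2_eq_square algebra_simps)
qed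

text \<open>Points of \<open>\<real>\<^sup>E\<close> are coordinate functions on the finite set \<open>E\<close>, so that the dimension may
  depend on numbers bound in a statement.\<close>

theorem colourful_caratheodory:
  fixes X :: "'i \<Rightarrow> 'b \<Rightarrow> 'e \<Rightarrow> real"
  assumes E: "finite E" and I: "finite I" and B: "finite B" and card: "card E < card I"
    and zero: "\<And>i. i \<in> I \<Longrightarrow> \<exists>p. (\<forall>b\<in>B. 0 \<le> p b) \<and> sum p B = 1 \<and>
                 (\<forall>e\<in>E. (\<Sum>b\<in>B. p b * X i b e) = 0)"
  shows "\<exists>c l. (\<forall>i\<in>I. c i \<in> B) \<and> (\<forall>i\<in>I. 0 \<le> l i) \<and> sum l I = 1 \<and>
                 (\<forall>e\<in>E. (\<Sum>i\<in>I. l i * X i (c i) e) = 0)"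
proof -
  define T where "T = {l :: 'i \<Rightarrow> real. (\<forall>i\<in>I. 0 \<le> l i \<and> l i \<le> 1) \<and>
      (\<forall>i. i \<notin> I \<longrightarrow> l i = 0) \<and> sum l I = 1}"
  \<comment> \<open>\<open>G c l\<close> is the point with weights \<open>l\<close> in the choice
    \<open>c\<close>, and \<open>Q c l\<close> its squared norm. The minimum of \<open>Q\<close>
    over both arguments will be shown to be 0.\<close>
  define G where "G c l e = (\<Sum>i\<in>I. l i * X i (c i) e)" for c l e
  define Q where "Q c l = (\<Sum>e\<in>E. (G c l e)\<^sup>2)" for c l
  have TI: "l \<in> T" if "\<And>i. i \<in> I \<Longrightarrow> 0 \<le> l i" "\<And>i. i \<notin> I \<Longrightarrow> l i = 0" "sum l I = 1" for l
  proof -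
    have "l i \<le> 1" if "i \<in> I" for i
      using member_le_sum[of i I l] that \<open>sum l I = 1\<close> \<open>\<And>i. i \<in> I \<Longrightarrow> 0 \<le> l i\<close> I by auto
    then show ?thesis
      using that by (auto simp: T_def)
  qed
  have "I \<noteq> {}"
    using card by auto
  then obtain i0 where i0: "i0 \<in> I"
    by blast
  have "B \<noteq> {}"
    using zero[OF i0] by auto
  define C where "C = PiE I (\<lambda>_. B)"
  have "finite C" "C \<noteq> {}"
    using I B \<open>B \<noteq> {}\<close> by (auto simp: C_def finite_PiE PiE_eq_empty_iff)
  have "(\<lambda>i. if i = i0 then 1 else 0) \<in> T"
    using i0 I by (intro TI) auto
  then have "T \<noteq> {}"
    by blast
  have "continuous_on T (Q c)" for c
    unfolding Q_def G_def
    by (intro continuous_intros continuous_on_subset[OF continuous_on_product_coordinates]) auto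
  moreover have "compact T"
    unfolding T_def by (rule compact_function_simplex)
  ultimately have "\<forall>c. \<exists>l\<in>T. \<forall>l'\<in>T. Q c l \<le> Q c l'"
    using continuous_attains_inf \<open>T \<noteq> {}\<close> by blast
  then obtain m where m: "\<And>c. m c \<in> T" "\<And>c l'. l' \<in> T \<Longrightarrow> Q c (m c) \<le> Q c l'"
    by metis
  obtain c where c: "c \<in> C" and cmin: "\<And>c'. c' \<in> C \<Longrightarrow> Q c (m c) \<le> Q c' (m c')"
    using arg_min_if_finite[OF \<open>finite C\<close> \<open>C \<noteq> {}\<close>, of "\<lambda>c. Q c (m c)"] by (meson not_le)
  define l where "l = m c"
  have l: "l \<in> T"
    by (simp add: l_def m)
  have min: "Q c l \<le> Q c' l'" if "c' \<in> C" "l' \<in> T" for c' l'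
    using cmin[OF that(1)] m(2)[OF that(2), of c'] by (simp add: l_def)
  define Z where "Z = G c l"
  define N where "N = Q c l"
  have N: "N = (\<Sum>e\<in>E. (Z e)\<^sup>2)"
    by (simp add: N_def Q_def Z_def)
  define ip where "ip i b = (\<Sum>e\<in>E. X i b e * Z e)" for i b
  \<comment> \<open>Only the point \<open>Z\<close> matters, not its representation: any choice and
    weights giving \<open>Z\<close> are also optimal, so moving from \<open>Z\<close> towards any of
    the chosen points cannot shorten it.\<close>
  have first_order: "N \<le> ip i (c' i)"
    if "c' \<in> C" "l' \<in> T" "\<And>e. e \<in> E \<Longrightarrow> G c' l' e = Z e" "i \<in> I" for c' l' i
  proof -
    define R where "R = (\<Sum>e\<in>E. (X i (c' i) e - Z e)\<^sup>2)"
    have "0 \<le> 2 * t * (ip i (c' i) - N) + t\<^sup>2 * R" if "0 < t" "t \<le> 1" for t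
    proof -
      define l'' where "l'' k = (1 - t) * l' k + t * (if k = i then 1 else 0)" for k
      have "l'' \<in> T"
      proof (rule TI)
        show "0 \<le> l'' k" if "k \<in> I" for k
          using that \<open>l' \<in> T\<close> \<open>0 < t\<close> \<open>t \<le> 1\<close> by (auto simp: l''_def T_def)
        show "l'' k = 0" if "k \<notin> I" for k
          using that \<open>l' \<in> T\<close> \<open>i \<in> I\<close> by (auto simp: l''_def T_def)
        show "sum l'' I = 1"
          using I \<open>l' \<in> T\<close> \<open>i \<in> I\<close>
          by (simp add: l''_def sum.distrib flip: sum_distrib_left) (simp add: T_def)
      qed
      have G: "G c' l'' e = Z e + t * (X i (c' i) e - Z e)" if "e \<in> E" for e
      proof -
        have "G c' l'' e = (1 - t) * G c' l' e + t * (\<Sum>k\<in>I. (if k = i then X k (c' k) e else 0))"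
          unfolding G_def l''_def sum_distrib_left sum.distrib[symmetric]
          by (intro sum.cong) (auto simp: algebra_simps)
        also have "(\<Sum>k\<in>I. (if k = i then X k (c' k) e else 0)) = X i (c' i) e"
          using I \<open>i \<in> I\<close> by simp
        finally show ?thesis
          using \<open>\<And>e. e \<in> E \<Longrightarrow> G c' l' e = Z e\<close>[OF that] by (simp add: algebra_simps)
      qed
      have "N \<le> Q c' l''"
        unfolding N_def by (rule min[OF \<open>c' \<in> C\<close> \<open>l'' \<in> T\<close>])
      also have "Q c' l'' = (\<Sum>e\<in>E. (Z e)\<^sup>2 + 2 * t * (X i (c' i) e * Z e - (Z e)\<^sup>2)
          + t\<^sup>2 * (X i (c' i) e - Z e)\<^sup>2)"
        unfolding Q_def by (intro sum.cong) (simp_all add: G, simp add: power2_eq_square algebra_simps)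
      also have "\<dots> = N + 2 * t * (ip i (c' i) - N) + t\<^sup>2 * R"
        by (simp add: N ip_def R_def sum.distrib sum_subtractf flip: sum_distrib_left)
      finally show ?thesis
        by simp
    qed
    then show ?thesis
      using quadratic_nonneg_near_zero_imp[of "ip i (c' i) - N" R] by simp
  qed
  have "N = 0"
  proof (rule ccontr)
    assume "N \<noteq> 0"
    then have "0 < N"
      unfolding N using sum_nonneg[of E "\<lambda>e. (Z e)\<^sup>2"] by simp
    \<comment> \<open>A colour carrying no weight could be switched for free to a point on the far side of the
        origin, against optimality.\<close>
    have positive: "0 < l' i" if "l' \<in> T" "\<And>e. e \<in> E \<Longrightarrow> G c l' e = Z e" "i \<in> I" for l' i
    proof (rule ccontr)
      assume "\<not> 0 < l' i"
      then have "l' i = 0"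
        using that by (auto simp: T_def intro: antisym)
      obtain p where p: "\<forall>b\<in>B. 0 \<le> p b" "sum p B = 1"
        "\<forall>e\<in>E. (\<Sum>b\<in>B. p b * X i b e) = 0"
        using zero[OF \<open>i \<in> I\<close>] by blast
      have "(\<Sum>b\<in>B. p b * ip i b) = (\<Sum>e\<in>E. (\<Sum>b\<in>B. p b * X i b e) * Z e)"
        unfolding ip_def sum_distrib_left sum_distrib_right
        by (subst sum.swap) (simp add: mult.assoc)
      then have pip: "(\<Sum>b\<in>B. p b * ip i b) = 0"
        using p by simp
      have "\<exists>b\<in>B. ip i b \<le> 0"
      proof (rule ccontr)
        assume "\<not> (\<exists>b\<in>B. ip i b \<le> 0)"
        then have pos: "0 < ip i b" if "b \<in> B" for b
          using that by auto
        have "\<forall>b\<in>B. p b * ip i b = 0"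
          using pip p(1) pos B by (subst (asm) sum_nonneg_eq_0_iff) (auto intro: mult_nonneg_nonneg less_imp_le)
        then have "\<forall>b\<in>B. p b = 0"
          using pos by fastforce
        then show False
          using p(2) by simp
      qed
      then obtain b where b: "b \<in> B" "ip i b \<le> 0"
        by blast
      have "c(i := b) \<in> C"
        using c b \<open>i \<in> I\<close> by (auto simp: C_def PiE_iff extensional_def)
      moreover have "G (c(i := b)) l' e = Z e" if "e \<in> E" for e
        unfolding \<open>\<And>e. e \<in> E \<Longrightarrow> G c l' e = Z e\<close>[OF that, symmetric] G_def
        using \<open>l' i = 0\<close> by (intro sum.cong) auto
      ultimately have "N \<le> ip i ((c(i := b)) i)"
        using first_order \<open>l' \<in> T\<close> \<open>i \<in> I\<close> by blast
      then show False
        using b \<open>0 < N\<close> by simp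
    qed
    \<comment> \<open>Every chosen point has inner product at least \<open>N\<close> with
      \<open>Z\<close>, while the weighted average is \<open>N\<close>. Since all weights are
      positive, all these points lie on one hyperplane.\<close>
    have ge: "N \<le> ip i (c i)" if "i \<in> I" for i
      using first_order[OF c l _ that] by (simp add: Z_def)
    have "(\<Sum>i\<in>I. l i * ip i (c i)) = (\<Sum>e\<in>E. (\<Sum>i\<in>I. l i * X i (c i) e) * Z e)"
      unfolding ip_def sum_distrib_left sum_distrib_right
      by (subst sum.swap) (simp add: mult.assoc)
    also have "\<dots> = N"
      unfolding N by (simp add: Z_def G_def power2_eq_square)
    finally have "(\<Sum>i\<in>I. l i * (ip i (c i) - N)) = 0"
      using l by (simp add: right_diff_distrib sum_subtractf T_def flip: sum_distrib_right)
    then have "\<forall>i\<in>I. l i * (ip i (c i) - N) = 0"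
      using ge l I by (subst (asm) sum_nonneg_eq_0_iff) (auto simp: T_def)
    moreover have "0 < l i" if "i \<in> I" for i
      using positive[OF l _ that] by (simp add: Z_def)
    ultimately have eq: "ip i (c i) = N" if "i \<in> I" for i
      using that by fastforce
    \<comment> \<open>The dependency becomes affine: a hyperplane missing the origin forces the
      coefficients to sum to 0. Shifting the weights along it leaves \<open>Z\<close>
      unchanged.\<close>
    obtain \<mu> where \<mu>: "\<exists>i\<in>I. \<mu> i \<noteq> 0"
      and dep: "\<And>e. e \<in> E \<Longrightarrow> (\<Sum>i\<in>I. X i (c i) e * \<mu> i) = 0"
      using homogeneous_system_nontrivial_solution[OF E I card, of "\<lambda>e i. X i (c i) e"] by blast
    have "(\<Sum>i\<in>I. \<mu> i * ip i (c i)) = (\<Sum>e\<in>E. (\<Sum>i\<in>I. X i (c i) e * \<mu> i) * Z e)"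
      unfolding ip_def sum_distrib_left sum_distrib_right
      by (subst sum.swap) (simp add: mult_ac)
    also have "\<dots> = 0"
      using dep by simp
    finally have "(\<Sum>i\<in>I. \<mu> i) * N = 0"
      using eq by (simp add: sum_distrib_right)
    then have sum\<mu>: "(\<Sum>i\<in>I. \<mu> i) = 0"
      using \<open>0 < N\<close> by simp
    define J where "J = {i\<in>I. 0 < \<mu> i}"
    have "J \<noteq> {}"
    proof
      assume "J = {}"
      then have "\<forall>i\<in>I. \<mu> i \<le> 0"
        by (auto simp: J_def not_less)
      then have "\<forall>i\<in>I. - \<mu> i = 0"
        using sum\<mu> I sum_nonneg_eq_0_iff[of I "\<lambda>i. - \<mu> i"] by (simp add: sum_negf)
      then show False
        using \<mu> by simp
    qed
    moreover have "finite J"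
      using I by (simp add: J_def)
    ultimately obtain q where q: "q \<in> J" and qmin: "\<And>i. i \<in> J \<Longrightarrow> l q / \<mu> q \<le> l i / \<mu> i"
      using arg_min_if_finite[of J "\<lambda>i. l i / \<mu> i"] by (meson not_le)
    \<comment> \<open>The largest step keeping all weights nonnegative; the weight of
      \<open>q\<close> drops to 0, against \<open>positive\<close>.\<close>
    define t where "t = l q / \<mu> q"
    have "0 \<le> t"
      using q l by (auto simp: t_def J_def T_def)
    define l' where "l' i = (if i \<in> I then l i - t * \<mu> i else 0)" for i
    have "l' \<in> T"
    proof (rule TI)
      show "0 \<le> l' i" if "i \<in> I" for i
      proof (cases "0 < \<mu> i")
        case True
        then show ?thesis
          using qmin[of i] that by (simp add: J_def l'_def t_def field_simps)
      next
        case False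
        then have "t * \<mu> i \<le> 0"
          using \<open>0 \<le> t\<close> by (simp add: mult_nonneg_nonpos)
        moreover have "0 \<le> l i"
          using l that by (simp add: T_def)
        ultimately show ?thesis
          by (simp add: l'_def)
      qed
      show "sum l' I = 1"
        using l sum\<mu> by (simp add: l'_def sum_subtractf T_def flip: sum_distrib_left)
    qed (simp add: l'_def)
    moreover have "G c l' e = Z e" if "e \<in> E" for e
    proof -
      have "G c l' e = G c l e - t * (\<Sum>i\<in>I. X i (c i) e * \<mu> i)"
        unfolding G_def l'_def sum_distrib_left sum_subtractf[symmetric]
        by (intro sum.cong) (auto simp: algebra_simps)
      then show ?thesis
        using dep[OF that] by (simp add: Z_def)
    qed
    ultimately have "0 < l' q"
      using positive q by (simp add: J_def)
    then show False
      using q by (simp add: l'_def t_def J_def)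
  qed
  then have "\<forall>e\<in>E. (\<Sum>i\<in>I. l i * X i (c i) e) = 0"
    unfolding N using E by (simp add: sum_nonneg_eq_0_iff Z_def G_def)
  moreover have "\<forall>i\<in>I. c i \<in> B"
    using c by (auto simp: C_def)
  ultimately show ?thesis
    using l by (intro exI[of _ c] exI[of _ l]) (auto simp: T_def)
qed

text \<open>Sarkaria's transformation: the vectors \<open>e\<^sub>0, \<dots>, e\<^sub>r\<^sub>-\<^sub>2, - (e\<^sub>0 + \<dots> + e\<^sub>r\<^sub>-\<^sub>2)\<close> of \<open>\<real>\<^sup>r\<^sup>-\<^sup>1\<close> have the
  constant ones as their only linear dependency, so tensoring with them turns a vanishing
  colourful combination into equality of the \<open>r\<close> partial sums.\<close>

theorem conic_tverberg:
  fixes x :: "'i \<Rightarrow> 'k \<Rightarrow> real"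
  assumes K: "finite K" and I: "finite I" and r: "0 < r" and card: "(r - 1) * card K < card I"
  shows "\<exists>c l. (\<forall>i\<in>I. c i < r) \<and> (\<forall>i\<in>I. 0 \<le> l i) \<and> sum l I = 1 \<and>
           (\<forall>k\<in>K. \<forall>j<r. (\<Sum>i\<in>{i\<in>I. c i = j}. l i * x i k) = (\<Sum>i\<in>{i\<in>I. c i = r - 1}. l i * x i k))"
proof -
  \<comment> \<open>For \<open>j < r - 1\<close> this is coordinate \<open>j\<close> of the vector
    of colour \<open>b\<close>: a unit vector, or minus the sum of the unit vectors when
    \<open>b = r - 1\<close>.\<close>
  define v :: "nat \<Rightarrow> nat \<Rightarrow> real"
    where "v b j = (if b = j then 1 else 0) - (if b = r - 1 then 1 else 0)" for b j
  \<comment> \<open>The uniform weights \<open>1 / r\<close> work, because the \<open>r\<close>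
    vectors sum to 0.\<close>
  have zero: "\<exists>p. (\<forall>b\<in>{..<r}. 0 \<le> p b) \<and> sum p {..<r} = 1 \<and>
      (\<forall>e\<in>{..<r-1} \<times> K. (\<Sum>b<r. p b * (v b (fst e) * x i (snd e))) = 0)" for i
  proof (intro exI conjI ballI)
    fix e
    assume "e \<in> {..<r-1} \<times> K"
    then have "fst e < r"
      by auto
    then have "(\<Sum>b<r. v b (fst e)) = 0"
      using r by (simp add: v_def sum_subtractf)
    then have "1 / real r * ((\<Sum>b<r. v b (fst e)) * x i (snd e)) = 0"
      by simp
    then show "(\<Sum>b<r. 1 / real r * (v b (fst e) * x i (snd e))) = 0"
      by (simp only: sum_distrib_left sum_distrib_right)
  qed (use r in auto)
  have "card ({..<r-1} \<times> K) < card I" "finite ({..<r-1} \<times> K)"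
    using card K by (simp_all add: card_cartesian_product)
  from colourful_caratheodory[where X = "\<lambda>i b e. v b (fst e) * x i (snd e)",
      OF this(2) I finite_lessThan this(1) zero]
  obtain c l where c: "\<forall>i\<in>I. c i \<in> {..<r}" and l: "\<forall>i\<in>I. 0 \<le> l i" "sum l I = 1"
    and eq: "\<forall>e\<in>{..<r-1} \<times> K. (\<Sum>i\<in>I. l i * (v (c i) (fst e) * x i (snd e))) = 0"
    by blast
  have "(\<Sum>i\<in>{i\<in>I. c i = j}. l i * x i k) = (\<Sum>i\<in>{i\<in>I. c i = r - 1}. l i * x i k)"
    if "k \<in> K" "j < r" for k j
  proof (cases "j = r - 1")
    case False
    \<comment> \<open>Coordinate \<open>j\<close> of the vectors is 1 on colour \<open>j\<close>, -1
      on colour \<open>r - 1\<close> and 0 on the others, so its vanishing equates two partial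
      sums.\<close>
    then have "0 = (\<Sum>i\<in>I. l i * (v (c i) j * x i k))"
      using bspec[OF eq, of "(j, k)"] that by simp
    also have "\<dots> = (\<Sum>i\<in>I. (if c i = j then l i * x i k else 0) - (if c i = r - 1 then l i * x i k else 0))"
      by (rule sum.cong) (simp_all add: v_def)
    also have "\<dots> = (\<Sum>i\<in>{i\<in>I. c i = j}. l i * x i k) - (\<Sum>i\<in>{i\<in>I. c i = r - 1}. l i * x i k)"
      using I by (simp only: sum_subtractf sum.inter_filter)
    finally show ?thesis
      by simp
  qed simp
  then show ?thesis
    using c l by (intro exI[of _ c] exI[of _ l] conjI ballI allI impI) blast+
qed

section \<open>Relabelling coordinates and a well-ordered index type\<close>

definition reindex :: "('b::finite \<Rightarrow> 'a::finite) \<Rightarrow> real ^ 'a \<Rightarrow> real ^ 'b" where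
  "reindex \<sigma> x = (\<chi> i. x $ \<sigma> i)"

lemma reindex_nth [simp]: "reindex \<sigma> x $ i = x $ \<sigma> i"
  by (simp add: reindex_def)

lemma linear_reindex: "linear (reindex \<sigma>)"
  by (rule linearI) (simp_all add: vec_eq_iff)

lemma reindex_inv_reindex:
  "bij \<sigma> \<Longrightarrow> reindex (inv \<sigma>) (reindex \<sigma> x) = x" "bij \<sigma> \<Longrightarrow> reindex \<sigma> (reindex (inv \<sigma>) y) = y"
  by (simp_all add: vec_eq_iff bij_def surj_f_inv_f)

lemma reindex_image_eq_vimage: "bij \<sigma> \<Longrightarrow> reindex \<sigma> ` S = reindex (inv \<sigma>) -` S"
proof (intro equalityI subsetI)
  fix y
  assume "bij \<sigma>" "y \<in> reindex (inv \<sigma>) -` S"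
  then show "y \<in> reindex \<sigma> ` S"
    by (intro image_eqI[of _ _ "reindex (inv \<sigma>) y"]) (auto simp: reindex_inv_reindex)
qed (auto simp: reindex_inv_reindex)

lemma norm_reindex:
  assumes "bij \<sigma>"
  shows "norm (reindex \<sigma> x) = norm x"
proof -
  have "(\<Sum>i\<in>UNIV. (x $ \<sigma> i)\<^sup>2) = (\<Sum>i\<in>UNIV. (x $ i)\<^sup>2)"
    using assms by (rule sum.reindex_bij_betw)
  then show ?thesis
    by (simp add: norm_vec_def L2_set_def)
qed

text \<open>Lebesgue measure is determined by boxes; relabelling turns a box into a box with the
  same side lengths in another order.\<close>

lemma lborel_distr_reindex:
  fixes \<sigma> :: "'b::finite \<Rightarrow> 'a::finite"
  assumes "bij \<sigma>"
  shows "distr lborel borel (reindex \<sigma>) = lborel"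
proof (rule lborel_eqI[symmetric])
  fix l u :: "real ^ 'b"
  assume le: "\<And>b. b \<in> Basis \<Longrightarrow> l \<bullet> b \<le> u \<bullet> b"
  let ?R = "reindex (inv \<sigma>)"
  have basis: "Basis = range (\<lambda>i. axis i (1::real))" "inj (\<lambda>i. axis i (1::real))"
    by (auto simp: Basis_vec_def inj_def axis_eq_axis)
  have "linear (reindex \<sigma>)"
    by (rule linear_reindex)
  then have [measurable]: "reindex \<sigma> \<in> borel_measurable borel"
    by (intro borel_measurable_continuous_onI linear_continuous_on linear_conv_bounded_linear[THEN iffD1])
  have "reindex \<sigma> -` box l u = box (?R l) (?R u)"
    unfolding set_eq_iff vimage_def mem_Collect_eq mem_box_cart reindex_nth
    by (metis assms bij_inv_eq_iff)
  then have "emeasure (distr lborel borel (reindex \<sigma>)) (box l u) = emeasure lborel (box (?R l) (?R u))"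
    by (simp add: emeasure_distr)
  also have "\<dots> = (\<Prod>b\<in>Basis. (?R u - ?R l) \<bullet> b)"
  proof (rule emeasure_lborel_box)
    fix b :: "real ^ 'a" assume "b \<in> Basis"
    then obtain i where "b = axis i 1" by (auto simp: Basis_vec_def)
    then show "?R l \<bullet> b \<le> ?R u \<bullet> b"
      using le[of "axis (inv \<sigma> i) 1"] by (simp add: inner_axis)
  qed
  also have "(\<Prod>b\<in>Basis. (?R u - ?R l) \<bullet> b) = (\<Prod>i\<in>UNIV. (u - l) $ inv \<sigma> i)"
    unfolding basis by (subst prod.reindex) (auto simp: inner_axis axis_eq_axis inj_def)
  also have "\<dots> = (\<Prod>i\<in>UNIV. (u - l) $ i)"
    by (rule prod.reindex_bij_betw) (use assms bij_imp_bij_inv in blast)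
  also have "\<dots> = (\<Prod>b\<in>Basis. (u - l) \<bullet> b)"
    unfolding basis by (subst prod.reindex) (auto simp: inner_axis axis_eq_axis inj_def)
  finally show "emeasure (distr lborel borel (reindex \<sigma>)) (box l u) = ennreal (\<Prod>b\<in>Basis. (u - l) \<bullet> b)" .
qed simp

lemma compact_ellipsoid: "ellipsoid E \<Longrightarrow> compact E"
  unfolding ellipsoid_def
  by (auto intro!: compact_continuous_image continuous_intros matrix_vector_mult_linear_continuous_on)

text \<open>The image is a preimage under the inverse relabelling, which preserves
  \<open>lborel\<close>. Compactness makes both sets Borel, where \<open>lebesgue\<close> and
  \<open>lborel\<close> agree.\<close>

lemma measure_reindex:
  assumes "bij \<sigma>" "compact S"
  shows "measure lebesgue (reindex \<sigma> ` S) = measure lebesgue S"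
proof -
  have inv: "bij (inv \<sigma>)"
    by (rule bij_imp_bij_inv[OF assms(1)])
  have cont: "continuous_on A (reindex \<tau>)" for A and \<tau> :: "'x::finite \<Rightarrow> 'y::finite"
    by (intro linear_continuous_on linear_conv_bounded_linear[THEN iffD1] linear_reindex)
  have meas: "reindex (inv \<sigma>) \<in> borel_measurable borel"
    by (intro borel_measurable_continuous_onI cont)
  have S: "S \<in> sets borel"
    using assms(2) by (simp add: borel_compact)
  have S': "reindex \<sigma> ` S \<in> sets borel"
    by (intro borel_compact compact_continuous_image cont assms)
  have "measure lebesgue (reindex \<sigma> ` S) = measure lborel (reindex \<sigma> ` S)"
    using S' by (intro measure_completion) auto
  also have "\<dots> = measure lborel (reindex (inv \<sigma>) -` S)"
    by (simp only: reindex_image_eq_vimage[OF assms(1)])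
  also have "\<dots> = measure (distr lborel borel (reindex (inv \<sigma>))) S"
    using S meas by (subst measure_distr) auto
  also have "\<dots> = measure lborel S"
    by (simp only: lborel_distr_reindex[OF inv])
  also have "\<dots> = measure lebesgue S"
    using S by (intro measure_completion[symmetric]) auto
  finally show ?thesis .
qed

text \<open>Relabelling maps the unit ball onto a unit ball, and \<open>A\<close> becomes its
  conjugate \<open>M A\<close>, whose inverse is the conjugate of the inverse.\<close>

lemma ellipsoid_reindex:
  fixes \<sigma> :: "'b::finite \<Rightarrow> 'a::finite"
  assumes "bij \<sigma>" "ellipsoid E"
  shows "ellipsoid (reindex \<sigma> ` E)"
proof -
  obtain A :: "real ^ 'a ^ 'a" and c where A: "invertible A" and E: "E = (\<lambda>x. A *v x + c) ` cball 0 1"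
    using assms(2) unfolding ellipsoid_def by blast
  define M where "M A = (\<chi> i j. A $ \<sigma> i $ \<sigma> j)" for A :: "real ^ 'a ^ 'a"
  have M: "M A *v reindex \<sigma> x = reindex \<sigma> (A *v x)" for A x
  proof -
    have "(\<Sum>j\<in>UNIV. A $ i $ \<sigma> j * x $ \<sigma> j) = (\<Sum>j\<in>UNIV. A $ i $ j * x $ j)" for i
      using assms(1) by (rule sum.reindex_bij_betw)
    then show ?thesis
      by (simp add: vec_eq_iff M_def matrix_vector_mult_def)
  qed
  obtain A' where A': "A ** A' = mat 1" "A' ** A = mat 1"
    using A by (auto simp: invertible_def)
  have MM: "M P ** M Q = mat 1" if "P ** Q = mat 1" for P Q
    unfolding matrix_eq
  proof
    fix y
    have "(M P ** M Q) *v reindex \<sigma> (reindex (inv \<sigma>) y) = mat 1 *v reindex \<sigma> (reindex (inv \<sigma>) y)"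
      by (simp only: matrix_vector_mul_assoc[symmetric] M) (simp add: matrix_vector_mul_assoc that)
    then show "(M P ** M Q) *v y = mat 1 *v y"
      using assms(1) by (simp add: reindex_inv_reindex)
  qed
  have "invertible (M A)"
    using MM[OF A'(1)] MM[OF A'(2)] by (auto simp: invertible_def)
  moreover have "reindex \<sigma> ` cball 0 1 = cball 0 1"
    using assms(1) by (auto simp: reindex_image_eq_vimage norm_reindex bij_imp_bij_inv)
  then have "(\<lambda>x. M A *v x + reindex \<sigma> c) ` cball 0 1 = (\<lambda>x. M A *v reindex \<sigma> x + reindex \<sigma> c) ` cball 0 1"
    by (metis (no_types, lifting) image_cong image_image)
  then have "reindex \<sigma> ` E = (\<lambda>x. M A *v x + reindex \<sigma> c) ` cball 0 1"
    by (simp add: E image_image M linear_add[OF linear_reindex])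
  ultimately show ?thesis
    unfolding ellipsoid_def by blast
qed

text \<open>The library states the volume formula for linear images only for well-ordered index types, hence
  a well-ordered copy of an arbitrary finite type.\<close>

typedef 'a ordered = "UNIV :: 'a set"
  by simp

instance ordered :: (finite) finite
proof
  have "(UNIV :: 'a ordered set) = range Abs_ordered"
    by (metis Rep_ordered_inverse surjI)
  then show "finite (UNIV :: 'a ordered set)"
    by (metis finite finite_imageI)
qed

definition enum_index :: "'a::finite \<Rightarrow> nat" where
  "enum_index = (SOME f. inj f)"

lemma inj_enum_index: "inj (enum_index :: 'a::finite \<Rightarrow> nat)"
proof -
  have "\<exists>f :: 'a \<Rightarrow> nat. inj f"
    using finite_imp_inj_to_nat_seg[of "UNIV :: 'a set"] by auto
  then show ?thesis
    unfolding enum_index_def by (rule someI_ex)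
qed

instantiation ordered :: (finite) wellorder
begin

definition less_eq_ordered :: "'a ordered \<Rightarrow> 'a ordered \<Rightarrow> bool" where
  "x \<le> y \<longleftrightarrow> enum_index (Rep_ordered x) \<le> enum_index (Rep_ordered y)"

definition less_ordered :: "'a ordered \<Rightarrow> 'a ordered \<Rightarrow> bool" where
  "x < y \<longleftrightarrow> enum_index (Rep_ordered x) < enum_index (Rep_ordered y)"

instance
proof
  fix P :: "'a ordered \<Rightarrow> bool" and a
  assume step: "\<And>x. (\<And>y. y < x \<Longrightarrow> P y) \<Longrightarrow> P x"
  show "P a"
    by (induction a rule: measure_induct_rule[of "\<lambda>x. enum_index (Rep_ordered x)"])
      (use step in \<open>auto simp: less_ordered_def\<close>)
qed (auto simp: less_eq_ordered_def less_ordered_def inj_eq[OF inj_enum_index] Rep_ordered_inject)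

end

lemma bij_Rep_ordered: "bij Rep_ordered"
  by (rule bij_betw_byWitness[where f' = Abs_ordered])
    (simp_all add: Rep_ordered_inverse Abs_ordered_inverse)

section \<open>Lower triangular normal form of ellipsoids\<close>

text \<open>Gram-Schmidt on the rows of \<open>A\<close> gives the columns of \<open>Q\<close>:
  column \<open>l\<close> is orthogonal to the earlier rows, which clears the entries above the
  diagonal.\<close>

lemma lower_triangular_orthogonal_factor:
  fixes A :: "real ^ 'n::{finite,wellorder} ^ 'n::{finite,wellorder}"
  assumes "invertible A"
  obtains Q where "orthogonal_matrix Q" "\<And>i j. i < j \<Longrightarrow> (A ** Q) $ i $ j = 0" "\<And>i. 0 < (A ** Q) $ i $ i"
proof -
  obtain B where B: "A ** B = mat 1"
    using assms by (auto simp: invertible_def)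
  have "\<exists>q. norm q = 1 \<and> q \<in> span ((\<lambda>k. A $ k) ` {..l}) \<and> (\<forall>k<l. A $ k \<bullet> q = 0) \<and> 0 < A $ l \<bullet> q" for l
  proof -
    let ?S = "(\<lambda>k. A $ k) ` {..<l}"
    have AB: "A $ k \<bullet> column l B = (if k = l then 1 else 0)" for k
    proof -
      have "A $ k \<bullet> column l B = (A ** B) $ k $ l"
        by (simp add: matrix_matrix_mult_def inner_vec_def column_def)
      then show ?thesis
        by (simp add: B mat_def)
    qed
    \<comment> \<open>Column \<open>l\<close> of the inverse is orthogonal to every row but row
      \<open>l\<close>, so that row is not in the span of the earlier ones.\<close>
    have notin: "A $ l \<notin> span ?S"
    proof
      assume "A $ l \<in> span ?S"
      then have "orthogonal (column l B) (A $ l)"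
        by (rule orthogonal_to_span) (auto simp: orthogonal_def AB inner_commute[of "column l B"])
      then show False
        using AB[of l] by (simp add: orthogonal_def inner_commute[of "column l B"])
    qed
    obtain y z where y: "y \<in> span ?S" and z: "\<And>w. w \<in> span ?S \<Longrightarrow> orthogonal z w" and yz: "A $ l = y + z"
      using orthogonal_subspace_decomp_exists[of ?S "A $ l"] by metis
    have "z \<noteq> 0"
      using notin y yz by auto
    have "z = A $ l - y"
      by (simp add: yz)
    moreover have "y \<in> span ((\<lambda>k. A $ k) ` {..l})"
      using y span_mono[of ?S "(\<lambda>k. A $ k) ` {..l}"] by force
    ultimately have "z \<in> span ((\<lambda>k. A $ k) ` {..l})"
      by (auto intro!: span_diff intro: span_base)
    moreover have "A $ k \<bullet> z = 0" if "k < l" for k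
      using z[of "A $ k"] that by (auto simp: orthogonal_def inner_commute intro: span_base)
    moreover have "A $ l \<bullet> z = z \<bullet> z"
      using z[OF y] by (simp add: yz inner_add_left orthogonal_def inner_commute[of z y])
    ultimately show ?thesis
      using \<open>z \<noteq> 0\<close>
      by (intro exI[of _ "z /\<^sub>R norm z"] conjI span_scale)
        (simp_all add: zero_less_mult_iff inner_gt_zero_iff)
  qed
  then obtain q where q: "\<And>l. norm (q l) = 1" "\<And>l. q l \<in> span ((\<lambda>k. A $ k) ` {..l})"
    "\<And>k l. k < l \<Longrightarrow> A $ k \<bullet> q l = 0" "\<And>l. 0 < A $ l \<bullet> q l"
    by metis
  define Q where "Q = (\<chi> i j. q j $ i)"
  have AQ: "(A ** Q) $ i $ j = A $ i \<bullet> q j" for i j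
    by (simp add: Q_def matrix_matrix_mult_def inner_vec_def)
  \<comment> \<open>\<open>q i\<close> lies in the span of the rows up to \<open>i\<close>, all
    earlier than row \<open>j\<close> and hence orthogonal to \<open>q j\<close>.\<close>
  have lt: "q i \<bullet> q j = 0" if "i < j" for i j
  proof -
    have "orthogonal (q j) (q i)"
    proof (rule orthogonal_to_span[OF q(2)])
      fix v
      assume "v \<in> (\<lambda>k. A $ k) ` {..i}"
      then show "orthogonal (q j) v"
        using q(3) that by (force simp: orthogonal_def inner_commute)
    qed
    then show ?thesis
      by (simp add: orthogonal_def inner_commute)
  qed
  have "q i \<bullet> q j = (if i = j then 1 else 0)" for i j
    using lt[of i j] lt[of j i] q(1)[of i] by (cases i j rule: linorder_cases) (auto simp: inner_commute norm_eq_1)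
  then have "transpose Q ** Q = mat 1"
    by (simp add: vec_eq_iff Q_def matrix_matrix_mult_def transpose_def mat_def inner_vec_def)
  then have "orthogonal_matrix Q"
    by (simp add: orthogonal_matrix)
  then show ?thesis
    using that q by (simp add: AQ)
qed

text \<open>Convex combinations keep this form, and there is one free parameter for each entry on or
  below the diagonal. The determinant is a product of positive entries.\<close>

definition lower_triangular_pos :: "real ^ 'n::{finite,wellorder} ^ 'n::{finite,wellorder} \<Rightarrow> bool" where
  "lower_triangular_pos L \<longleftrightarrow> (\<forall>i j. i < j \<longrightarrow> L $ i $ j = 0) \<and> (\<forall>i. 0 < L $ i $ i)"

lemma det_lower_triangular_pos: "lower_triangular_pos L \<Longrightarrow> det L = (\<Prod>i\<in>UNIV. L $ i $ i)"
  by (rule det_lowerdiagonal) (simp add: lower_triangular_pos_def)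

lemma prod_diagonal_pos: "lower_triangular_pos L \<Longrightarrow> 0 < (\<Prod>i\<in>UNIV. L $ i $ i)"
  by (rule prod_pos) (simp add: lower_triangular_pos_def)

lemma ellipsoid_lower_triangular_pos:
  assumes "lower_triangular_pos L"
  shows "ellipsoid ((\<lambda>x. L *v x + c) ` cball 0 1)"
proof -
  have "invertible L"
    using assms by (auto simp: invertible_det_nz det_lower_triangular_pos)
      (simp add: lower_triangular_pos_def less_le)
  then show ?thesis
    unfolding ellipsoid_def by blast
qed

text \<open>An orthogonal matrix \<open>Q\<close> maps the ball onto itself, so \<open>A\<close> and
  \<open>A ** Q\<close> describe the same ellipsoid.\<close>

lemma ellipsoid_obtain_lower_triangular_pos:
  fixes E :: "(real ^ 'n::{finite,wellorder}) set"
  assumes "ellipsoid E"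
  obtains L c where "lower_triangular_pos L" "E = (\<lambda>x. L *v x + c) ` cball 0 1"
proof -
  obtain A :: "real ^ 'n::_ ^ 'n::_" and c where A: "invertible A" and E: "E = (\<lambda>x. A *v x + c) ` cball 0 1"
    using assms unfolding ellipsoid_def by blast
  obtain Q where Q: "orthogonal_matrix Q" and AQ: "\<And>i j. i < j \<Longrightarrow> (A ** Q) $ i $ j = 0" "\<And>i. 0 < (A ** Q) $ i $ i"
    using lower_triangular_orthogonal_factor[OF A] by blast
  have "orthogonal_transformation ((*v) Q)"
    using Q by (simp add: orthogonal_transformation_matrix)
  then have "(*v) Q ` cball 0 1 = cball 0 1"
    by (simp add: image_orthogonal_transformation_cball)
  then have "(\<lambda>x. A *v x + c) ` (*v) Q ` cball 0 1 = E"
    by (simp add: E)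
  then have "E = (\<lambda>x. (A ** Q) *v x + c) ` cball 0 1"
    by (simp add: image_image matrix_vector_mul_assoc)
  moreover have "lower_triangular_pos (A ** Q)"
    using AQ by (simp add: lower_triangular_pos_def)
  ultimately show ?thesis
    using that by blast
qed

lemma measure_ellipsoid_lower_triangular_pos:
  fixes L :: "real ^ 'n::{finite,wellorder} ^ 'n::{finite,wellorder}"
  assumes "lower_triangular_pos L"
  shows "measure lebesgue ((\<lambda>x. L *v x + c) ` cball 0 1) =
    (\<Prod>i\<in>UNIV. L $ i $ i) * measure lebesgue (cball (0 :: real ^ 'n::_) 1)"
proof -
  have "(\<lambda>x. L *v x + c) ` cball 0 1 = (+) c ` (*v) L ` cball 0 1"
    by (auto simp: image_image add.commute)
  then have "measure lebesgue ((\<lambda>x. L *v x + c) ` cball 0 1) = measure lebesgue ((*v) L ` cball 0 1)"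
    by (simp only: measure_translation)
  also have "\<dots> = \<bar>det (matrix ((*v) L))\<bar> * measure lebesgue (cball (0 :: real ^ 'n::_) 1)"
    by (rule measure_linear_image) auto
  finally show ?thesis
    using prod_diagonal_pos[OF assms] by (simp add: det_lower_triangular_pos assms)
qed

section \<open>Log-concavity of products of positive numbers\<close>

lemma weighted_sum_pos:
  fixes w a :: "'i \<Rightarrow> real"
  assumes "finite S" "\<And>i. i \<in> S \<Longrightarrow> 0 \<le> w i" "sum w S = 1" "\<And>i. i \<in> S \<Longrightarrow> 0 < a i"
  shows "0 < (\<Sum>i\<in>S. w i * a i)"
proof -
  obtain i where i: "i \<in> S" "w i \<noteq> 0"
    using assms(3) by (metis sum.neutral zero_neq_one)
  then have "0 < w i * a i"
    using assms(2,4) by (metis mult_pos_pos order_le_less)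
  then show ?thesis
    using i assms by (intro sum_pos2[of S i]) (auto simp: less_imp_le)
qed

text \<open>Jensen's inequality for the logarithm in each factor \<open>k\<close>. With
  \<open>a i\<close> the diagonal of a triangular matrix, averaging matrices of equal determinant
  does not lower the determinant.\<close>

lemma prod_weighted_sum_ge:
  fixes w :: "'i \<Rightarrow> real" and a :: "'i \<Rightarrow> 'k \<Rightarrow> real"
  assumes S: "finite S" and T: "finite T" and w: "\<And>i. i \<in> S \<Longrightarrow> 0 \<le> w i" "sum w S = 1"
    and a: "\<And>i k. i \<in> S \<Longrightarrow> k \<in> T \<Longrightarrow> 0 < a i k" and prod: "\<And>i. i \<in> S \<Longrightarrow> (\<Prod>k\<in>T. a i k) = \<kappa>"
  shows "\<kappa> \<le> (\<Prod>k\<in>T. \<Sum>i\<in>S. w i * a i k)"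
proof -
  have "S \<noteq> {}"
    using w(2) by auto
  then obtain i0 where "i0 \<in> S"
    by blast
  have "0 < \<kappa>"
    using prod[OF \<open>i0 \<in> S\<close>] a[OF \<open>i0 \<in> S\<close>] prod_pos[of T "a i0"] by simp
  have pos: "0 < (\<Sum>i\<in>S. w i * a i k)" if "k \<in> T" for k
    using weighted_sum_pos[OF S w a] that by simp
  have "ln \<kappa> = (\<Sum>i\<in>S. w i * ln \<kappa>)"
    using w(2) by (simp flip: sum_distrib_right)
  also have "\<dots> = (\<Sum>i\<in>S. \<Sum>k\<in>T. w i * ln (a i k))"
  proof (rule sum.cong)
    fix i
    assume "i \<in> S"
    then have "ln \<kappa> = (\<Sum>k\<in>T. ln (a i k))"
      unfolding prod[OF \<open>i \<in> S\<close>, symmetric] using T a[OF \<open>i \<in> S\<close>] by (intro ln_prod) (auto simp: less_le)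
    then show "w i * ln \<kappa> = (\<Sum>k\<in>T. w i * ln (a i k))"
      by (simp add: sum_distrib_left)
  qed simp
  also have "\<dots> = (\<Sum>k\<in>T. \<Sum>i\<in>S. w i * ln (a i k))"
    by (rule sum.swap)
  also have "\<dots> \<le> (\<Sum>k\<in>T. ln (\<Sum>i\<in>S. w i * a i k))"
  proof (rule sum_mono)
    fix k
    assume "k \<in> T"
    then show "(\<Sum>i\<in>S. w i * ln (a i k)) \<le> ln (\<Sum>i\<in>S. w i * a i k)"
      using concave_on_sum[OF S \<open>S \<noteq> {}\<close> ln_concave w(2) w(1), of "\<lambda>i. a i k"] a by simp
  qed
  also have "\<dots> = ln (\<Prod>k\<in>T. \<Sum>i\<in>S. w i * a i k)"
    using T pos by (intro ln_prod[symmetric]) (auto simp: less_le)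
  finally show ?thesis
    using \<open>0 < \<kappa>\<close> pos by (subst (asm) ln_le_cancel_iff) (auto intro: prod_pos)
qed

section \<open>Tverberg theorem for ellipsoids of volume one\<close>

text \<open>The triangle and its reflection cover the square and overlap in the diagonal.\<close>

lemma card_lower_triangle:
  "2 * card {(a, b). b \<le> (a :: 'n::{finite,linorder})} = CARD('n) * (CARD('n) + 1)"
proof -
  let ?L = "{(a :: 'n, b). b \<le> a}" and ?U = "{(a :: 'n, b). a \<le> b}"
  have "?U = prod.swap ` ?L"
    by force
  then have "card ?U = card ?L"
    by (metis card_image inj_swap inj_on_subset subset_UNIV)
  moreover have "card ?U + card ?L = card (?U \<union> ?L) + card (?U \<inter> ?L)"
    by (rule card_Un_Int) auto
  moreover have "?U \<union> ?L = UNIV"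
    by auto
  moreover have "?U \<inter> ?L = (\<lambda>a. (a, a)) ` UNIV"
    by auto
  moreover have "card ((\<lambda>a :: 'n. (a, a)) ` UNIV) = CARD('n)"
    by (rule card_image) (simp add: inj_on_def)
  moreover have "CARD('n \<times> 'n) = CARD('n) * CARD('n)"
    by simp
  ultimately show ?thesis
    by (simp add: algebra_simps)
qed

text \<open>A well-ordered index type gives triangularity a meaning and admits the determinant
  formula for volumes; arbitrary finite index types are reached by relabelling afterwards.\<close>

theorem ellipsoid_tverberg_ordered:
  fixes F :: "'i \<Rightarrow> (real ^ 'n::{finite,wellorder}) set"
  assumes r: "0 < r" and I: "finite I"
    and card: "card I = (r - 1) * (CARD('n) * (CARD('n) + 3) div 2) + 1"
    and ell: "\<And>i. i \<in> I \<Longrightarrow> ellipsoid (F i)"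
    and vol: "\<And>i. i \<in> I \<Longrightarrow> measure lebesgue (F i) = 1"
  shows "\<exists>P. partition_on I P \<and> card P = r \<and>
           (\<exists>E. ellipsoid E \<and> measure lebesgue E = 1 \<and>
                E \<subseteq> (\<Inter>A\<in>P. convex hull (\<Union>i\<in>A. F i)))"
proof -
  have "\<forall>i\<in>I. \<exists>L c. lower_triangular_pos L \<and> F i = (\<lambda>x. L *v x + c) ` cball 0 1"
    using ell ellipsoid_obtain_lower_triangular_pos by metis
  then obtain L c where L: "\<And>i. i \<in> I \<Longrightarrow> lower_triangular_pos (L i)"
    and F: "\<And>i. i \<in> I \<Longrightarrow> F i = (\<lambda>x. L i *v x + c i) ` cball 0 1"
    by metis
  define \<omega> where "\<omega> = measure lebesgue (cball (0 :: real ^ 'n::_) 1)"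
  have diag: "(\<Prod>a\<in>UNIV. L i $ a $ a) * \<omega> = 1" if "i \<in> I" for i
    using vol[OF that] measure_ellipsoid_lower_triangular_pos[OF L[OF that], of "c i"]
    by (simp add: F that \<omega>_def)
  have "I \<noteq> {}"
    using card by auto
  then obtain i0 where i0: "i0 \<in> I"
    by blast
  have \<omega>: "0 < \<omega>"
    using diag[OF i0] prod_diagonal_pos[OF L[OF i0]] by (metis zero_less_mult_pos zero_less_one)
  have prod_diag: "(\<Prod>a\<in>UNIV. L i $ a $ a) = 1 / \<omega>" if "i \<in> I" for i
    using diag[OF that] \<omega> by (simp add: field_simps)

  define m :: 'n where "m = Max UNIV"
  have m: "a < m" if "a \<noteq> m" for a
    using that by (simp add: m_def less_le)
  \<comment> \<open>Omitting \<open>(m, m)\<close> loses one coordinate and the constant coordinate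
    \<open>Inl None\<close> regains it: with \<open>d\<close> coordinates for the centre,
    \<open>card K\<close> is exactly \<open>d (d + 3) / 2\<close>.\<close>
  define T where "T = {(a, b). b \<le> (a :: 'n)} - {(m, m)}"
  define K :: "('n option + 'n \<times> 'n) set" where "K = UNIV <+> T"
  \<comment> \<open>The constant coordinate 1 forces the total weights of the \<open>r\<close> parts
    to agree.\<close>
  define x where "x i k = (case k of Inl None \<Rightarrow> 1 | Inl (Some a) \<Rightarrow> c i $ a | Inr (a, b) \<Rightarrow> L i $ a $ b)" for i k
  have "card T = card {(a, b). b \<le> (a :: 'n)} - 1"
    unfolding T_def by (subst card_Diff_singleton) auto
  moreover have "0 < card {(a, b). b \<le> (a :: 'n)}"
    by (subst card_gt_0_iff) auto
  ultimately have "2 * card K = CARD('n) * (CARD('n) + 3)"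
    using card_lower_triangle[where 'n = 'n] by (simp add: K_def card_Plus card_option algebra_simps)
  then have "(r - 1) * card K < card I"
    using card by (metis add.commute less_add_one nonzero_mult_div_cancel_left zero_neq_numeral)
  moreover have "finite K"
    by simp
  ultimately obtain col l where col: "\<And>i. i \<in> I \<Longrightarrow> col i < r" and l: "\<And>i. i \<in> I \<Longrightarrow> 0 \<le> l i" "sum l I = 1"
    and eq: "\<And>k j. k \<in> K \<Longrightarrow> j < r \<Longrightarrow>
      (\<Sum>i\<in>{i\<in>I. col i = j}. l i * x i k) = (\<Sum>i\<in>{i\<in>I. col i = r - 1}. l i * x i k)"
    using conic_tverberg[OF _ I r, of K x] by blast

  define part where "part j = {i\<in>I. col i = j}" for j
  \<comment> \<open>The parts have equal total weight, namely \<open>1 / r\<close>; the factor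
    \<open>r\<close> turns each into a convex combination.\<close>
  define w where "w i = real r * l i" for i
  have fin: "finite (part j)" and sub: "i \<in> part j \<Longrightarrow> i \<in> I" for i j
    using I by (auto simp: part_def)
  have w: "0 \<le> w i" if "i \<in> part j" for i j
    using l(1)[OF sub[OF that]] by (simp add: w_def)
  have weq: "(\<Sum>i\<in>part j. w i * x i k) = (\<Sum>i\<in>part (r - 1). w i * x i k)" if "k \<in> K" "j < r" for k j
    using eq[OF that] by (simp add: w_def part_def mult.assoc flip: sum_distrib_left)
  define s0 where "s0 = sum w (part (r - 1))"
  have s0: "sum w (part j) = s0" if "j < r" for j
    using weq[of "Inl None" j] that by (simp add: K_def x_def InlI s0_def)
  have "sum w I = (\<Sum>j<r. sum w (part j))"
    unfolding part_def using I col by (intro sum.group[symmetric]) auto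
  also have "\<dots> = real r * s0"
    by (simp add: s0)
  finally have "s0 = 1"
    using l(2) r by (simp add: w_def flip: sum_distrib_left)
  then have w1: "sum w (part j) = 1" if "j < r" for j
    using s0[OF that] by simp

  define cc where "cc = (\<Sum>i\<in>part (r - 1). w i *\<^sub>R c i)"
  define M where "M j = (\<Sum>i\<in>part j. w i *\<^sub>R L i)" for j
  have cc: "cc = (\<Sum>i\<in>part j. w i *\<^sub>R c i)" if "j < r" for j
    using weq[OF _ that, of "Inl (Some _)"] by (simp add: cc_def vec_eq_iff K_def x_def InlI)
  have M_nth: "M j $ a $ b = (\<Sum>i\<in>part j. w i * L i $ a $ b)" for j a b
    by (simp add: M_def)
  have M_tri: "M j $ a $ b = 0" if "a < b" for j a b
    unfolding M_nth using L[OF sub] that by (intro sum.neutral) (auto simp: lower_triangular_pos_def)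
  have M_eq: "M j $ a $ b = M j' $ a $ b" if "j < r" "j' < r" "(a, b) \<noteq> (m, m)" for j j' a b
  proof (cases "a < b")
    case False
    then have "Inr (a, b) \<in> K"
      using that by (auto simp: K_def T_def)
    then show ?thesis
      using weq[of "Inr (a, b)" j] weq[of "Inr (a, b)" j'] that by (simp add: M_nth x_def)
  qed (simp add: M_tri)
  have M_pos: "0 < M j $ a $ a" if "j < r" for j a
    unfolding M_nth using L[OF sub] by (intro weighted_sum_pos fin w w1 that) (auto simp: lower_triangular_pos_def)
  have M_prod: "1 / \<omega> \<le> (\<Prod>a\<in>UNIV. M j $ a $ a)" if "j < r" for j
    unfolding M_nth using L[OF sub] prod_diag[OF sub]
    by (intro prod_weighted_sum_ge fin w w1 that) (auto simp: lower_triangular_pos_def)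

  obtain j0 where j0: "j0 < r" and j0_min: "\<And>j. j < r \<Longrightarrow> M j0 $ m $ m \<le> M j $ m $ m"
    using arg_min_if_finite[of "{..<r}" "\<lambda>j. M j $ m $ m"] r
    by (metis finite_lessThan lessThan_empty_iff lessThan_iff not_gr_zero not_le)
  define p where "p = (\<Prod>a\<in>UNIV. M j0 $ a $ a)"
  have p: "0 < p" "1 / \<omega> \<le> p"
    using M_prod[OF j0] \<omega> by (auto simp: p_def intro: prod_pos M_pos[OF j0])
  \<comment> \<open>Shrinking by \<open>s\<close> about the centre brings the volume
    \<open>p * \<omega>\<close> down to one; \<open>s \<le> 1\<close> since this volume is at least
    one.\<close>
  define s where "s = root CARD('n) (1 / \<omega> / p)"
  have s_pow: "s ^ CARD('n) = 1 / \<omega> / p"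
    unfolding s_def using p \<omega> by (intro real_root_pow_pos2) auto
  have s: "0 < s" "s \<le> 1"
    unfolding s_def using p \<omega> by (auto simp: real_root_gt_0_iff real_root_le_1_iff field_simps)
  have tri: "lower_triangular_pos (s *\<^sub>R M j0)"
    using s M_tri M_pos[OF j0] by (simp add: lower_triangular_pos_def)
  define E where "E = (\<lambda>x. (s *\<^sub>R M j0) *v x + cc) ` cball 0 1"
  have "ellipsoid E"
    unfolding E_def by (rule ellipsoid_lower_triangular_pos[OF tri])
  moreover have "measure lebesgue E = 1"
  proof -
    have "measure lebesgue E = (\<Prod>a\<in>UNIV. s * M j0 $ a $ a) * \<omega>"
      unfolding E_def \<omega>_def using measure_ellipsoid_lower_triangular_pos[OF tri] by simp
    also have "\<dots> = s ^ CARD('n) * p * \<omega>"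
      by (simp add: prod.distrib p_def)
    also have "\<dots> = 1"
      using p \<omega> by (simp add: s_pow)
    finally show ?thesis .
  qed
  moreover have "E \<subseteq> convex hull (\<Union>i\<in>part j. F i)" if j: "j < r" for j
  proof
    fix z
    assume "z \<in> E"
    then obtain u where u: "norm u \<le> 1" and z: "z = (s *\<^sub>R M j0) *v u + cc"
      by (auto simp: E_def)
    define \<rho> where "\<rho> = M j0 $ m $ m / M j $ m $ m"
    have \<rho>: "0 \<le> \<rho>" "\<rho> \<le> 1"
      using j0_min[OF j] M_pos[OF j, of m] M_pos[OF j0, of m] by (auto simp: \<rho>_def)
    \<comment> \<open>\<open>M j\<close> sends \<open>y\<close> where
      \<open>s *\<^sub>R M j0\<close> sends \<open>u\<close>, and \<open>y\<close> stays in the ball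
      because both factors are at most 1.\<close>
    define y where "y = (\<chi> b. (if b = m then \<rho> * s else s) * u $ b)"
    have "norm y \<le> norm u"
    proof (rule norm_le_componentwise_cart)
      fix b
      have "0 \<le> (if b = m then \<rho> * s else s)" "(if b = m then \<rho> * s else s) \<le> 1"
        using \<rho> s by (auto simp: mult_le_one)
      then show "norm (y $ b) \<le> norm (u $ b)"
        by (simp add: y_def abs_mult mult_left_le_one_le)
    qed
    then have y: "y \<in> cball 0 1"
      using u by simp
    \<comment> \<open>In a lower triangular matrix the last column has only its diagonal entry, so that increasing
        this entry amounts to stretching the ball along the last coordinate.\<close>
    have "(s *\<^sub>R M j0) $ a $ b * u $ b = M j $ a $ b * y $ b" for a b
    proof (cases "b = m")
      case False
      then show ?thesis
        using M_eq[OF j0 j, of a b] by (simp add: y_def)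
    next
      case True
      then show ?thesis
        using M_tri[of a m] m[of a] M_pos[OF j, of m] by (cases "a = m") (simp_all add: y_def \<rho>_def)
    qed
    then have "(s *\<^sub>R M j0) *v u = M j *v y"
      by (simp only: vec_eq_iff matrix_vector_mult_def vec_lambda_beta) simp
    also have "\<dots> = (\<Sum>i\<in>part j. w i *\<^sub>R (L i *v y))"
      by (simp add: vec_eq_iff matrix_vector_mult_def M_nth sum_distrib_left sum_distrib_right
          mult.assoc sum.swap[of _ UNIV])
    \<comment> \<open>One and the same \<open>y\<close> serves every \<open>i\<close>, so
      \<open>z\<close> is a convex combination of the points \<open>L i *v y + c i\<close> of the
      ellipsoids \<open>F i\<close>.\<close>
    finally have "z = (\<Sum>i\<in>part j. w i *\<^sub>R (L i *v y + c i))"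
      by (simp add: z cc[OF j] scaleR_add_right sum.distrib)
    also have "\<dots> \<in> convex hull (\<Union>i\<in>part j. F i)"
    proof (intro convex_sum fin convex_convex_hull w1 j w)
      fix i
      assume "i \<in> part j"
      then show "L i *v y + c i \<in> convex hull (\<Union>i\<in>part j. F i)"
        using y by (intro hull_inc UN_I[of i]) (auto simp: F[OF sub])
    qed
    finally show "z \<in> convex hull (\<Union>i\<in>part j. F i)" .
  qed
  \<comment> \<open>Weights summing to one rule out an empty part, so there are exactly
    \<open>r\<close> distinct classes.\<close>
  moreover have ne: "part j \<noteq> {}" if "j < r" for j
    using w1[OF that] by auto
  have "partition_on I (part ` {..<r})"
    using ne col by (intro partition_onI) (auto simp: part_def disjnt_def)
  moreover have "card (part ` {..<r}) = r"
  proof -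
    have "inj_on part {..<r}"
      using ne by (intro inj_onI) (force simp: part_def)
    then show ?thesis
      by (simp add: card_image)
  qed
  ultimately show ?thesis
    by (intro exI[of _ "part ` {..<r}"] conjI exI[of _ E]) auto
qed

section \<open>Transfer to an arbitrary finite index type\<close>

theorem theorem4p8:
  fixes r :: nat
    and I :: "'i set"
    and F :: "'i \<Rightarrow> (real ^ 'd) set"
  assumes "primepow r"
    and "finite I"
    and "card I = (r - 1) * (CARD('d) * (CARD('d) + 3) div 2) + 1"
    and "\<And>i. i \<in> I \<Longrightarrow> ellipsoid (F i)"
    and "\<And>i. i \<in> I \<Longrightarrow> measure lebesgue (F i) = 1"
  shows "\<exists>P. partition_on I P \<and> card P = r \<and>
           (\<exists>E. ellipsoid E \<and> measure lebesgue E = 1 \<and>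
                E \<subseteq> (\<Inter>A\<in>P. convex hull (\<Union>i\<in>A. F i)))"
proof -
  let ?\<sigma> = "Rep_ordered :: 'd ordered \<Rightarrow> 'd"
  have \<sigma>: "bij ?\<sigma>" "bij (inv ?\<sigma>)"
    using bij_Rep_ordered bij_imp_bij_inv by blast+
  have "0 < r"
    using primepow_gt_Suc_0[OF assms(1)] by simp
  moreover have "CARD('d ordered) = CARD('d)"
    by (rule bij_betw_same_card[OF \<sigma>(1)])
  then have "card I = (r - 1) * (CARD('d ordered) * (CARD('d ordered) + 3) div 2) + 1"
    using assms(3) by simp
  moreover have "ellipsoid (reindex ?\<sigma> ` F i)" "measure lebesgue (reindex ?\<sigma> ` F i) = 1" if "i \<in> I" for i
    using assms(4,5)[OF that] \<sigma>(1) by (simp_all add: ellipsoid_reindex measure_reindex compact_ellipsoid)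
  ultimately obtain P E where P: "partition_on I P" "card P = r"
    and E: "ellipsoid E" "measure lebesgue E = 1"
    and sub: "E \<subseteq> (\<Inter>A\<in>P. convex hull (\<Union>i\<in>A. reindex ?\<sigma> ` F i))"
    using ellipsoid_tverberg_ordered[of r I "\<lambda>i. reindex ?\<sigma> ` F i"] assms(2) by metis
  \<comment> \<open>The ellipsoid is carried back along the inverse relabelling, which is linear and
    hence commutes with convex hulls.\<close>
  let ?E = "reindex (inv ?\<sigma>) ` E"
  have "?E \<subseteq> convex hull (\<Union>i\<in>A. F i)" if "A \<in> P" for A
  proof -
    have "?E \<subseteq> reindex (inv ?\<sigma>) ` (convex hull (\<Union>i\<in>A. reindex ?\<sigma> ` F i))"
      using sub that by blast
    also have "\<dots> = convex hull (reindex (inv ?\<sigma>) ` (\<Union>i\<in>A. reindex ?\<sigma> ` F i))"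
      by (rule convex_hull_linear_image[OF linear_reindex])
    also have "reindex (inv ?\<sigma>) ` (\<Union>i\<in>A. reindex ?\<sigma> ` F i) = (\<Union>i\<in>A. F i)"
      by (simp add: image_UN image_image reindex_inv_reindex \<sigma>)
    finally show ?thesis .
  qed
  moreover have "ellipsoid ?E" "measure lebesgue ?E = 1"
    using E \<sigma>(2) by (simp_all add: ellipsoid_reindex measure_reindex compact_ellipsoid)
  ultimately show ?thesis
    using P by blast
qed

end
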